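(* For any non-negative integer $n$ and any prime $p$ there exists a finite $p$-group $P$ such that $P \in \mathcal{CD}(P)$ and $\mathcal{CD}(P)$ is a chain of length $n$. The group $P$ can be chosen in such a way that both $P/\mathrm{Z}(P)$ and $\mathrm{Z}(P)$ are elementary abelian.
   Context: For a finite group $G$ and a subgroup $U \le G$, the Chermak-Delgado measure of $U$ in $G$ is $m_G(U) = |U|\,|C_G(U)|$. Put $m(G) = \max\{m_G(U) \mid U \le G\}$ and $\mathcal{CD}(G) = \{U \le G \mid m_G(U) = m(G)\}$, the Chermak-Delgado lattice of $G$. A chain of length $n$ is a series of subgroups $G_0 < G_1 < \dots < G_n$ with proper inclusions (so it has exactly $n+1$ members). $\mathrm{Z}(P)$ denotes the center of $P$. The trivial group counts as elementary abelian. *)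

theory Defs
  imports "HOL-Algebra.Algebra" "HOL-Computational_Algebra.Primes"
begin

definition centralizer :: "('a, 'b) monoid_scheme \<Rightarrow> 'a set \<Rightarrow> 'a set" where
  "centralizer G U = {g \<in> carrier G. \<forall>u\<in>U. g \<otimes>\<^bsub>G\<^esub> u = u \<otimes>\<^bsub>G\<^esub> g}"

definition group_center :: "('a, 'b) monoid_scheme \<Rightarrow> 'a set" where
  "group_center G = centralizer G (carrier G)"

definition CD_measure :: "('a, 'b) monoid_scheme \<Rightarrow> 'a set \<Rightarrow> nat" where
  "CD_measure G U = card U * card (centralizer G U)"

definition max_CD_measure :: "('a, 'b) monoid_scheme \<Rightarrow> nat" where
  "max_CD_measure G = Max {CD_measure G U |U. subgroup U G}"

definition CD_lattice :: "('a, 'b) monoid_scheme \<Rightarrow> 'a set set" where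
  "CD_lattice G = {U. subgroup U G \<and> CD_measure G U = max_CD_measure G}"

definition finite_p_group :: "nat \<Rightarrow> ('a, 'b) monoid_scheme \<Rightarrow> bool" where
  "finite_p_group p G \<longleftrightarrow> group G \<and> finite (carrier G) \<and> (\<exists>k. order G = p ^ k)"

text \<open>Meant for prime \<open>p\<close>; the trivial group is included.\<close>

definition elementary_abelian :: "nat \<Rightarrow> ('a, 'b) monoid_scheme \<Rightarrow> bool" where
  "elementary_abelian p G \<longleftrightarrow>
     comm_group G \<and> (\<forall>x\<in>carrier G. x [^]\<^bsub>G\<^esub> p = \<one>\<^bsub>G\<^esub>)"

text \<open>The length counts the proper inclusions, so the chain has \<open>n + 1\<close> members.\<close>

definition subgroup_chain_of_length ::
  "('a, 'b) monoid_scheme \<Rightarrow> nat \<Rightarrow> 'a set set \<Rightarrow> bool" where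
  "subgroup_chain_of_length G n C \<longleftrightarrow>
     (\<exists>H :: nat \<Rightarrow> 'a set. C = H ` {..n} \<and>
        (\<forall>i\<le>n. subgroup (H i) G) \<and> (\<forall>i<n. H i \<subset> H (Suc i)))"

end

theory Submission
  imports Defs
begin

text \<open>
  Let \<open>V\<close> be an \<open>\<F>\<^sub>p\<close>-space with \<open>n\<close> layers of three basis vectors each, and let \<open>P\<close> be the class-two
  group on \<open>V \<times> W\<close> whose commutator form is the alternating form on \<open>V\<close> that is generic subject to
  layers \<open>i\<close> and \<open>j\<close> commuting whenever \<open>i + j \<le> n\<close> (layers counted from 1). If \<open>P\<^sub>k\<close> is the preimage of the
  span of the first \<open>k\<close> layers, then \<open>P\<^sub>n\<^sub>-\<^sub>k\<close> centralizes \<open>P\<^sub>k\<close>, so every \<open>P\<^sub>k\<close> has the same measure.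
  Conversely, take \<open>U\<close> and the least \<open>k\<close> with \<open>U \<le> P\<^sub>k\<close>. Either \<open>C(U) \<le> P\<^sub>n\<^sub>-\<^sub>k\<close>, and then the measure of \<open>U\<close>
  is at most that of \<open>P\<^sub>k\<close>, with equality only for \<open>U = P\<^sub>k\<close>; or genericity forces \<open>2k > n\<close> and ties all
  coordinates above layer \<open>n - k\<close> to a single one, both in \<open>U\<close> and in \<open>C(U)\<close>, which makes the
  measure too small because layers have dimension at least three.
\<close>

section \<open>The matrix group\<close>

text \<open>Layers are counted from 0 here: basis vector \<open>e\<close> lies in layer \<open>e div 3\<close>.\<close>

definition linked :: "nat \<Rightarrow> nat \<Rightarrow> nat \<Rightarrow> bool" where
  "linked n e f \<longleftrightarrow> e < f \<and> n \<le> e div 3 + f div 3 + 1"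

text \<open>Keeps the bilinear term off the diagonal, so the diagonal entries multiply by plain
  addition mod \<open>p\<close>.\<close>

lemma not_linked_self [simp]: "\<not> linked n e e"
  by (simp add: linked_def)

abbreviation entries :: "nat \<Rightarrow> (nat \<times> nat) set" where
  "entries n \<equiv> {..<3 * n} \<times> {..<3 * n}"

text \<open>Extensional functions with reduced entries: each residue matrix has exactly one
  representative, so equality can be checked entry by entry.\<close>

definition matrices :: "nat \<Rightarrow> nat \<Rightarrow> (nat \<times> nat \<Rightarrow> int) set" where
  "matrices n p = entries n \<rightarrow>\<^sub>E {0..<int p}"

text \<open>
  The diagonal of a matrix holds the coordinates in \<open>V\<close>, the off-diagonal entries those in \<open>W\<close>.
  Unlinked off-diagonal entries only contribute a direct factor to the center.
\<close>

definition mat_mult ::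
  "nat \<Rightarrow> nat \<Rightarrow> (nat \<times> nat \<Rightarrow> int) \<Rightarrow> (nat \<times> nat \<Rightarrow> int) \<Rightarrow> nat \<times> nat \<Rightarrow> int" where
  "mat_mult n p x y = (\<lambda>(e, f)\<in>entries n.
     (x (e, f) + y (e, f) + (if linked n e f then x (e, e) * y (f, f) else 0)) mod int p)"

definition mat_zero :: "nat \<Rightarrow> nat \<times> nat \<Rightarrow> int" where
  "mat_zero n = (\<lambda>i\<in>entries n. 0)"

definition mat_group :: "nat \<Rightarrow> nat \<Rightarrow> (nat \<times> nat \<Rightarrow> int) monoid" where
  "mat_group n p = \<lparr>carrier = matrices n p, monoid.mult = mat_mult n p, one = mat_zero n\<rparr>"

lemma mat_mult_apply:
  assumes "e < 3 * n" "f < 3 * n"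
  shows "mat_mult n p x y (e, f) =
    (x (e, f) + y (e, f) + (if linked n e f then x (e, e) * y (f, f) else 0)) mod int p"
  using assms by (simp add: mat_mult_def)

lemma mat_mult_diag: "e < 3 * n \<Longrightarrow> mat_mult n p x y (e, e) = (x (e, e) + y (e, e)) mod int p"
  by (simp add: mat_mult_def linked_def)

lemma finite_matrices: "finite (matrices n p)"
  unfolding matrices_def by (intro finite_PiE) auto

lemma card_matrices: "card (matrices n p) = p ^ (9 * n * n)"
  by (simp add: matrices_def card_PiE card_cartesian_product algebra_simps)

lemma mat_mult_closed: "p > 0 \<Longrightarrow> mat_mult n p x y \<in> matrices n p"
  by (simp add: mat_mult_def matrices_def restrict_PiE_iff split_beta)

lemma mat_zero_closed: "p > 0 \<Longrightarrow> mat_zero n \<in> matrices n p"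
  by (simp add: mat_zero_def matrices_def restrict_PiE_iff)

lemma group_mat_group:
  assumes "p > 0"
  shows "group (mat_group n p)"
proof (rule groupI)
  show "x \<otimes>\<^bsub>mat_group n p\<^esub> y \<in> carrier (mat_group n p)" for x y
    using assms by (simp add: mat_group_def mat_mult_closed)
next
  show "\<one>\<^bsub>mat_group n p\<^esub> \<in> carrier (mat_group n p)"
    using assms by (simp add: mat_group_def mat_zero_closed)
next
  fix x y z
  have "mat_mult n p (mat_mult n p x y) z i = mat_mult n p x (mat_mult n p y z) i" for i
  proof (cases "i \<in> entries n")
    case True
    then obtain e f where i: "i = (e, f)" and ef: "e < 3 * n" "f < 3 * n" by auto
    show ?thesis
    proof (cases "linked n e f")
      case True
      \<comment> \<open>Both bracketings give the same three cross terms, since the correction is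
        bilinear in the diagonals and these add. The inner reductions mod \<open>p\<close> are first
        removed, then put back.\<close>
      have "mat_mult n p (mat_mult n p x y) z i =
          ((x (e, f) + y (e, f) + x (e, e) * y (f, f)) mod int p + z (e, f)
            + (x (e, e) + y (e, e)) mod int p * z (f, f)) mod int p"
        using True ef by (simp add: i mat_mult_apply mat_mult_diag)
      also have "\<dots> = (x (e, f) + y (e, f) + x (e, e) * y (f, f) + z (e, f)
            + (x (e, e) + y (e, e)) * z (f, f)) mod int p"
        by (intro mod_add_cong mod_mult_cong mod_mod_trivial refl)
      also have "\<dots> = (x (e, f) + (y (e, f) + z (e, f) + y (e, e) * z (f, f))
            + x (e, e) * (y (f, f) + z (f, f))) mod int p"
        by (simp add: algebra_simps)
      also have "\<dots> = (x (e, f) + (y (e, f) + z (e, f) + y (e, e) * z (f, f)) mod int p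
            + x (e, e) * ((y (f, f) + z (f, f)) mod int p)) mod int p"
        by (intro mod_add_cong mod_mult_cong mod_mod_trivial[symmetric] refl)
      also have "\<dots> = mat_mult n p x (mat_mult n p y z) i"
        using True ef by (simp add: i mat_mult_apply mat_mult_diag)
      finally show ?thesis .
    next
      case False
      then show ?thesis using ef by (simp add: i mat_mult_apply mod_simps algebra_simps)
    qed
  qed (simp add: mat_mult_def)
  then show "x \<otimes>\<^bsub>mat_group n p\<^esub> y \<otimes>\<^bsub>mat_group n p\<^esub> z = x \<otimes>\<^bsub>mat_group n p\<^esub> (y \<otimes>\<^bsub>mat_group n p\<^esub> z)"
    by (auto simp: mat_group_def)
next
  fix x assume "x \<in> carrier (mat_group n p)"
  then have x: "x \<in> entries n \<rightarrow>\<^sub>E {0..<int p}" by (simp add: mat_group_def matrices_def)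
  have "mat_mult n p (mat_zero n) x i = x i" for i
  proof (cases "i \<in> entries n")
    case True
    then show ?thesis using PiE_mem[OF x True] by (auto simp: mat_mult_def mat_zero_def)
  next
    case False
    then show ?thesis using PiE_arb[OF x] by (simp add: mat_mult_def)
  qed
  then show "\<one>\<^bsub>mat_group n p\<^esub> \<otimes>\<^bsub>mat_group n p\<^esub> x = x"
    by (auto simp: mat_group_def)
  \<comment> \<open>A left inverse must have diagonal -x, so its product with \<open>x\<close> picks
    up the cross term -\<open>x (e, e) * x (f, f)\<close>; the positive term here cancels
    that.\<close>
  define y where "y = (\<lambda>(e, f)\<in>entries n.
    (- x (e, f) + (if linked n e f then x (e, e) * x (f, f) else 0)) mod int p)"
  have "mat_mult n p y x i = mat_zero n i" for i
  proof (cases "i \<in> entries n")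
    case True
    then obtain e f where i: "i = (e, f)" and ef: "e < 3 * n" "f < 3 * n" by auto
    have "mat_mult n p y x i = (y (e, f) + x (e, f) + (if linked n e f then y (e, e) * x (f, f) else 0)) mod int p"
      using ef by (simp add: i mat_mult_apply)
    also have "\<dots> = (- x (e, f) + (if linked n e f then x (e, e) * x (f, f) else 0)
        + x (e, f) + (if linked n e f then - x (e, e) * x (f, f) else 0)) mod int p"
    proof -
      have "y (e, f) mod int p = (- x (e, f) + (if linked n e f then x (e, e) * x (f, f) else 0)) mod int p"
        using ef by (simp add: y_def)
      moreover have "(y (e, e) * x (f, f)) mod int p = (- x (e, e) * x (f, f)) mod int p"
      proof -
        have "y (e, e) = (- x (e, e)) mod int p" using ef by (simp add: y_def linked_def)
        then show ?thesis by (simp only: mod_mult_left_eq)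
      qed
      ultimately show ?thesis
        by (intro mod_add_cong) simp_all
    qed
    also have "\<dots> = 0" by simp
    also have "\<dots> = mat_zero n i" using True by (simp add: mat_zero_def)
    finally show ?thesis .
  qed (simp add: mat_mult_def mat_zero_def)
  then have "mat_mult n p y x = mat_zero n" ..
  moreover have "y \<in> matrices n p"
    using assms by (simp add: y_def matrices_def restrict_PiE_iff split_beta)
  ultimately show "\<exists>y\<in>carrier (mat_group n p). y \<otimes>\<^bsub>mat_group n p\<^esub> x = \<one>\<^bsub>mat_group n p\<^esub>"
    by (auto simp: mat_group_def)
qed

section \<open>Coordinates and layers in an isomorphic copy of the matrix group\<close>

locale chain_group = group P for P :: "'a monoid" (structure) +
  fixes n p :: nat and c :: "'a \<Rightarrow> nat \<times> nat \<Rightarrow> int"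
  assumes prime: "Factorial_Ring.prime p"
    and bij: "bij_betw c (carrier P) (matrices n p)"
    and c_mult: "\<lbrakk>x \<in> carrier P; y \<in> carrier P\<rbrakk> \<Longrightarrow> c (x \<otimes> y) = mat_mult n p (c x) (c y)"
    and c_one: "c \<one> = mat_zero n"
begin

abbreviation d :: "'a \<Rightarrow> nat \<Rightarrow> int" where
  "d x e \<equiv> c x (e, e)"

text \<open>This is the full preimage \<open>P_k\<close>: only diagonal entries are constrained, so
  all of the central part \<open>W\<close> belongs to every layer.\<close>

definition layer :: "nat \<Rightarrow> 'a set" where
  "layer k = {x \<in> carrier P. \<forall>e. 3 * k \<le> e \<and> e < 3 * n \<longrightarrow> d x e = 0}"

lemma p_pos: "p > 0" and p_gt_1: "p > 1"
  using prime prime_gt_0_nat prime_gt_1_nat by auto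

lemma finite_carrier: "finite (carrier P)"
  using bij bij_betw_finite finite_matrices by blast

lemma order_eq: "order P = p ^ (9 * n * n)"
  using bij_betw_same_card[OF bij] by (simp add: order_def card_matrices)

lemma c_range: "\<lbrakk>x \<in> carrier P; e < 3 * n; f < 3 * n\<rbrakk> \<Longrightarrow> c x (e, f) \<in> {0..<int p}"
  using bij_betwE[OF bij] unfolding matrices_def by (meson PiE_mem SigmaI lessThan_iff)

lemma c_eqI:
  assumes "x \<in> carrier P" "y \<in> carrier P" "\<And>i. i \<in> entries n \<Longrightarrow> c x i = c y i"
  shows "x = y"
proof -
  have "c x \<in> matrices n p" "c y \<in> matrices n p" using assms bij_betwE[OF bij] by auto
  then have "c x = c y" using assms(3) unfolding matrices_def by (intro PiE_ext)
  then show ?thesis using bij assms by (auto simp: bij_betw_def dest: inj_onD)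
qed

lemma c_zero_iff: "\<lbrakk>x \<in> carrier P; e < 3 * n; f < 3 * n\<rbrakk> \<Longrightarrow> int p dvd c x (e, f) \<longleftrightarrow> c x (e, f) = 0"
  using c_range[of x e f] by (auto dest: zdvd_imp_le)

lemma d_one: "e < 3 * n \<Longrightarrow> d \<one> e = 0"
  by (simp add: c_one mat_zero_def)

lemma d_mult: "\<lbrakk>x \<in> carrier P; y \<in> carrier P; e < 3 * n\<rbrakk> \<Longrightarrow> d (x \<otimes> y) e = (d x e + d y e) mod int p"
  by (simp add: c_mult mat_mult_diag)

lemma d_inv:
  assumes "x \<in> carrier P" "e < 3 * n"
  shows "d (inv x) e = (- d x e) mod int p"
proof -
  have "(d (inv x) e + d x e) mod int p = 0"
    using d_mult[of "inv x" x e] assms by (simp add: d_one)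
  then have "d (inv x) e mod int p = (- d x e) mod int p"
    by (simp add: mod_eq_dvd_iff mod_eq_0_iff_dvd)
  then show ?thesis using c_range[of "inv x" e e] assms by simp
qed

lemma d_pow: "\<lbrakk>x \<in> carrier P; e < 3 * n\<rbrakk> \<Longrightarrow> d (x [^] (k :: nat)) e = (int k * d x e) mod int p"
  by (induction k) (simp_all add: d_one d_mult mod_simps algebra_simps)

text \<open>Comparing one linked entry of the two products leaves only the bilinear terms, so a 2 by
  2 minor of the diagonals vanishes mod \<open>p\<close>. The hypothesis is symmetric in
  \<open>e\<close> and \<open>f\<close>, so the ordering built into \<open>linked\<close> is handled
  by cases.\<close>

lemma commute_linked:
  assumes "x \<in> carrier P" "y \<in> carrier P" "x \<otimes> y = y \<otimes> x" "e < 3 * n" "f < 3 * n"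
    and "n \<le> e div 3 + f div 3 + 1"
  shows "(d x f * d y e) mod int p = (d y f * d x e) mod int p"
proof -
  have *: "(d x a * d y b) mod int p = (d y a * d x b) mod int p"
    if "linked n a b" "a < 3 * n" "b < 3 * n" for a b
  proof -
    have "c (x \<otimes> y) (a, b) = c (y \<otimes> x) (a, b)" using assms(3) by simp
    then have "(c x (a, b) + c y (a, b) + d x a * d y b) mod int p
      = (c x (a, b) + c y (a, b) + d y a * d x b) mod int p"
      using assms(1,2) that by (simp add: c_mult mat_mult_apply add.commute)
    then show ?thesis
      by (simp add: mod_eq_dvd_iff)
  qed
  consider "e = f" | "linked n e f" | "linked n f e"
    using assms(6) by (cases e f rule: linorder_cases) (auto simp: linked_def add.commute)
  then show ?thesis
  proof cases
    case 2
    then show ?thesis using *[of e f] assms by (simp add: mult.commute)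
  next
    case 3
    then show ?thesis using *[of f e] assms by simp
  qed (simp add: mult.commute)
qed

lemma layer_subset: "layer k \<subseteq> carrier P"
  by (auto simp: layer_def)

lemma layer_n: "layer n = carrier P"
  by (auto simp: layer_def)

lemma subgroup_layer: "subgroup (layer k) P"
proof (rule subgroupI)
  show "layer k \<noteq> {}" using d_one by (auto simp: layer_def)
qed (auto simp: layer_def d_inv d_mult)

text \<open>If two coordinates satisfy the linking bound, the first lies outside the first
  \<open>k\<close> layers or the second outside the first \<open>n - k\<close>. Hence every bilinear
  term of either product is zero.\<close>

lemma layer_commute:
  assumes "x \<in> layer k" "y \<in> layer (n - k)" "k \<le> n"
  shows "x \<otimes> y = y \<otimes> x"
proof -
  have x: "x \<in> carrier P" and y: "y \<in> carrier P" using assms by (auto simp: layer_def)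
  have zero: "d x a * d y b = 0"
    if "n \<le> a div 3 + b div 3 + 1" "a < 3 * n" "b < 3 * n" for a b
  proof (cases "3 * k \<le> a")
    case True
    then show ?thesis using assms(1) that by (simp add: layer_def)
  next
    case False
    then have "a div 3 < k" by auto
    then have "n - k \<le> b div 3" using that(1) by linarith
    then have "3 * (n - k) \<le> b" by linarith
    then show ?thesis using assms(2) that by (simp add: layer_def)
  qed
  show ?thesis
  proof (rule c_eqI)
    fix i assume "i \<in> entries n"
    then obtain e f where i: "i = (e, f)" "e < 3 * n" "f < 3 * n" by auto
    have "linked n e f \<Longrightarrow> d x e * d y f = 0 \<and> d y e * d x f = 0"
      using zero[of e f] zero[of f e] i by (auto simp: linked_def mult.commute add.commute)
    then show "c (x \<otimes> y) i = c (y \<otimes> x) i"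
      using x y i by (auto simp: c_mult mat_mult_apply add.commute)
  qed (use x y in auto)
qed

lemma layer_le_centralizer: "k \<le> n \<Longrightarrow> layer (n - k) \<subseteq> centralizer P (layer k)"
  using layer_commute layer_subset by (fastforce simp: centralizer_def)

section \<open>Counting layers and tied sets\<close>

lemma card_diag: "A \<subseteq> {..<3 * n} \<Longrightarrow> card (entries n - (\<lambda>e. (e, e)) ` A) = 9 * n * n - card A"
  by (subst card_Diff_subset)
    (auto simp: card_cartesian_product card_image inj_on_def finite_subset algebra_simps)

lemma card_layer:
  assumes "k \<le> n"
  shows "card (layer k) = p ^ (9 * n * n - 3 * (n - k))"
proof -
  define T where "T = (\<lambda>e. (e, e)) ` {3 * k..<3 * n}"
  \<comment> \<open>In coordinates the layer is a box: factor {0} at the diagonal positions forced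
    to vanish, a full residue range elsewhere.\<close>
  define F where "F i = (if i \<in> T then {0} else {0..<int p})" for i
  have T: "T \<subseteq> entries n" by (auto simp: T_def)
  have "bij_betw c (layer k) (PiE (entries n) F)"
    unfolding bij_betw_def
  proof
    show "inj_on c (layer k)"
      using bij layer_subset by (auto simp: bij_betw_def intro: inj_on_subset)
    have "PiE (entries n) F = {m \<in> matrices n p. \<forall>i\<in>T. m i = 0}"
    proof -
      have 1: "m \<in> entries n \<rightarrow>\<^sub>E {0..<int p}" if "m \<in> PiE (entries n) F" for m
        using that by (rule subsetD[OF PiE_mono, rotated]) (use p_pos in \<open>auto simp: F_def\<close>)
      have 2: "m i = 0" if "m \<in> PiE (entries n) F" "i \<in> T" for m i
        using PiE_mem[OF that(1), of i] that(2) T by (auto simp: F_def)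
      have 3: "m \<in> PiE (entries n) F"
        if "m \<in> entries n \<rightarrow>\<^sub>E {0..<int p}" "\<forall>i\<in>T. m i = 0" for m
        using that by (intro PiE_I) (auto simp: F_def dest: PiE_mem PiE_arb)
      show ?thesis
        unfolding matrices_def by (intro equalityI subsetI CollectI conjI ballI) (simp_all add: 1 2 3)
    qed
    also have "\<dots> = c ` layer k"
      unfolding bij_betw_imp_surj_on[OF bij, symmetric] by (auto simp: layer_def T_def)
    finally show "c ` layer k = PiE (entries n) F" ..
  qed
  then have "card (layer k) = (\<Prod>i\<in>entries n. card (F i))"
    by (simp add: bij_betw_same_card card_PiE)
  also have "\<dots> = (\<Prod>i\<in>entries n - T. card (F i)) * (\<Prod>i\<in>T. card (F i))"
    using T by (intro prod.subset_diff) auto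
  also have "\<dots> = p ^ card (entries n - T)"
    by (simp add: F_def)
  also have "card (entries n - T) = 9 * n * n - 3 * (n - k)"
    unfolding T_def by (subst card_diag) (auto simp: diff_mult_distrib2)
  finally show ?thesis .
qed

text \<open>Since \<open>g e\<close> is invertible mod \<open>p\<close>, the diagonal coordinate at
  the pivot \<open>e\<close> determines all those in \<open>A\<close>. Only one of the
  \<open>card A\<close> coordinates is therefore free.\<close>

lemma card_tied_le:
  assumes U: "U \<subseteq> carrier P" and A: "e \<in> A" "A \<subseteq> {..<3 * n}"
    and g: "\<not> int p dvd g e"
    and tied: "\<And>x f. x \<in> U \<Longrightarrow> f \<in> A \<Longrightarrow> (d x f * g e) mod int p = (g f * d x e) mod int p"
  shows "card U \<le> p ^ (9 * n * n - (card A - 1))"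
proof -
  \<comment> \<open>The entries that determine an element of \<open>U\<close>; the pivot position
    stays in.\<close>
  define J where "J = entries n - (\<lambda>e. (e, e)) ` (A - {e})"
  have "inj_on (\<lambda>x. restrict (c x) J) U"
  proof (rule inj_onI)
    fix x y assume xy: "x \<in> U" "y \<in> U" and "restrict (c x) J = restrict (c y) J"
    then have J: "c x i = c y i" if "i \<in> J" for i
      using that by (metis restrict_apply')
    show "x = y"
    proof (rule c_eqI)
      fix i assume i: "i \<in> entries n"
      show "c x i = c y i"
      proof (cases "i \<in> J")
        case False
        then obtain f where f: "i = (f, f)" "f \<in> A" using i by (auto simp: J_def)
        have "d x e = d y e" using A by (intro J) (auto simp: J_def)
        then have "(d x f * g e) mod int p = (d y f * g e) mod int p"
          using tied[OF xy(1) f(2)] tied[OF xy(2) f(2)] by simp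
        then have "int p dvd (d x f - d y f) * g e"
          by (simp add: mod_eq_dvd_iff left_diff_distrib)
        then have "int p dvd d x f - d y f"
          using g prime by (auto simp: prime_dvd_mult_iff)
        then have "d x f mod int p = d y f mod int p" by (simp add: mod_eq_dvd_iff)
        moreover have "d x f \<in> {0..<int p}" "d y f \<in> {0..<int p}"
          using U xy f A by (auto intro!: c_range simp del: atLeastLessThan_iff)
        ultimately show ?thesis using f by simp
      qed (rule J)
    qed (use U xy in auto)
  qed
  moreover have "(\<lambda>x. restrict (c x) J) ` U \<subseteq> J \<rightarrow>\<^sub>E {0..<int p}"
    using U by (auto simp: restrict_PiE_iff J_def subset_iff intro!: c_range simp del: atLeastLessThan_iff)
  moreover have fin: "finite J" by (auto simp: J_def)
  ultimately have "card U \<le> card (J \<rightarrow>\<^sub>E {0..<int p})"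
    by (intro card_inj_on_le finite_PiE) auto
  also have "\<dots> = p ^ card J" using fin by (simp add: card_PiE)
  also have "card J = 9 * n * n - (card A - 1)"
    unfolding J_def using A by (subst card_diag) (auto simp: finite_subset)
  finally show ?thesis .
qed

section \<open>Bounding the Chermak-Delgado measure\<close>

definition top_measure :: nat where
  "top_measure = p ^ (2 * (9 * n * n) - 3 * n)"

text \<open>Ensures that the natural-number subtractions in the exponents do not truncate.\<close>

lemma three_le: "3 * n \<le> 9 * n * n"
  by (cases n) auto

lemma card_layer_mult:
  assumes "k \<le> n"
  shows "card (layer k) * card (layer (n - k)) = top_measure"
proof -
  have "9 * n * n - 3 * (n - k) + (9 * n * n - 3 * k) = 2 * (9 * n * n) - 3 * n"
    using assms three_le by linarith
  then show ?thesis
    using assms by (simp add: card_layer top_measure_def flip: power_add)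
qed

lemma finite_centralizer: "finite (centralizer P U)"
  using finite_carrier by (auto simp: centralizer_def)

text \<open>The inclusion of \<open>layer (n - k)\<close> in the centralizer gives this half; the
  matching upper bound comes from \<open>CD_measure_le\<close>.\<close>

lemma CD_measure_layer_ge: "k \<le> n \<Longrightarrow> top_measure \<le> CD_measure P (layer k)"
  unfolding CD_measure_def
  by (metis card_layer_mult card_mono finite_centralizer layer_le_centralizer mult_le_mono2)

lemma CD_measure_dichotomy:
  assumes U: "U \<subseteq> carrier P"
  shows "CD_measure P U < top_measure \<or>
    (\<exists>k\<le>n. U \<subseteq> layer k \<and> centralizer P U \<subseteq> layer (n - k))"
proof -
  define C where "C = centralizer P U"
  have C: "C \<subseteq> carrier P" by (auto simp: C_def centralizer_def)
  define k where "k = (LEAST k. U \<subseteq> layer k)"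
  have "U \<subseteq> layer n" using U by (simp add: layer_n)
  then have Uk: "U \<subseteq> layer k" and kn: "k \<le> n"
    unfolding k_def by (rule LeastI, rule Least_le)
  show ?thesis
  proof (cases "C \<subseteq> layer (n - k)")
    case True
    then show ?thesis using Uk kn C_def by blast
  next
    case False
    \<comment> \<open>For \<open>k = 0\<close> the target \<open>layer n\<close> would be the whole
      group. So \<open>k - 1\<close> is a true predecessor, and minimality yields an element of
      \<open>U\<close> with a nonzero coordinate in layer \<open>k - 1\<close>.\<close>
    then have "k \<noteq> 0" using C by (metis diff_zero layer_n)
    then have "\<not> U \<subseteq> layer (k - 1)"
      using not_less_Least[of "k - 1" "\<lambda>k. U \<subseteq> layer k"] by (simp add: k_def)
    then obtain u e where u: "u \<in> U" "u \<in> carrier P"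
      and e: "3 * (k - 1) \<le> e" "e < 3 * n" "d u e \<noteq> 0"
      using U by (auto simp: layer_def)
    have u0: "d u f = 0" if "3 * k \<le> f" "f < 3 * n" for f
      using u Uk that by (auto simp: layer_def)
    have ek: "e < 3 * k" using u0[of e] e by linarith
    obtain v f where v: "v \<in> C" "v \<in> carrier P"
      and f: "3 * (n - k) \<le> f" "f < 3 * n" "d v f \<noteq> 0"
      using False C by (auto simp: layer_def)
    \<comment> \<open>With layers counted from 0, \<open>i\<close> and \<open>j\<close> fail to
      commute when \<open>n \<le> i + j + 1\<close>. As \<open>e\<close> is in layer
      \<open>k - 1\<close>, it meets every layer from \<open>n - k\<close> on.\<close>
    have far: "n \<le> e div 3 + a div 3 + 1" if "3 * (n - k) \<le> a" for a
    proof -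
      have "n - k \<le> a div 3" "k - 1 \<le> e div 3" using that e(1) by simp_all
      then show ?thesis using kn by linarith
    qed
    have tied: "(d x a * d y e) mod int p = (d y a * d x e) mod int p"
      if "x \<in> U" "y \<in> C" "3 * (n - k) \<le> a" "a < 3 * n" for x y a
      using that U e(2) far by (intro commute_linked) (auto simp: C_def centralizer_def)
    have "\<not> int p dvd d u e" using e u c_zero_iff by simp
    moreover have "\<not> int p dvd d v f" using f v c_zero_iff by simp
    ultimately have "\<not> int p dvd d v f * d u e"
      using prime by (auto simp: prime_dvd_mult_iff)
    \<comment> \<open>The tie carries the nonzero product over to the other side. Thus
      \<open>d v e\<close> is invertible and can serve as pivot for \<open>U\<close>, while
      \<open>d u f\<close> is nonzero, which places \<open>f\<close> below \<open>3 * k\<close> and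
      forces \<open>n < 2 * k\<close>.\<close>
    then have nz: "\<not> int p dvd d u f * d v e"
      using tied[OF u(1) v(1) f(1,2)] by (simp add: dvd_eq_mod_eq_0)
    then have "d u f \<noteq> 0" by auto
    then have "f < 3 * k" using u0[of f] f by linarith
    then have kn2: "n < 2 * k" using f kn by linarith
    \<comment> \<open>All coordinates from layer \<open>n - k\<close> on. The pivot \<open>e\<close>
      is among them because \<open>n < 2 * k\<close> gives \<open>n - k \<le> k - 1\<close>.\<close>
    define A where "A = {3 * (n - k)..<3 * n}"
    have cA: "card A = 3 * k" using kn by (simp add: A_def diff_mult_distrib2)
    have eA: "e \<in> A" using e kn2 by (simp add: A_def)
    have "card U \<le> p ^ (9 * n * n - (card A - 1))"
      using U eA nz tied v by (intro card_tied_le[where g = "d v" and e = e]) (auto simp: A_def)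
    moreover have "card C \<le> p ^ (9 * n * n - (card A - 1))"
      using C eA \<open>\<not> int p dvd d u e\<close> tied u
      by (intro card_tied_le[where g = "d u" and e = e]) (auto simp: A_def)
    ultimately have "card U * card C \<le> p ^ (2 * (9 * n * n - (3 * k - 1)))"
      unfolding cA mult_2 power_add by (rule mult_le_mono)
    also have "\<dots> < top_measure"
    proof -
      \<comment> \<open>Each of \<open>U\<close> and \<open>C\<close> loses \<open>3 * k - 1\<close>
        dimensions. With \<open>2 * k \<ge> n + 1\<close> the total loss is at least
        \<open>3 * n + 1\<close>; layers of dimension two would only give \<open>2 * n\<close>,
        which is not strict.\<close>
      have "2 * (9 * n * n - (3 * k - 1)) < 2 * (9 * n * n) - 3 * n"
        using kn kn2 three_le by linarith
      then show ?thesis unfolding top_measure_def using p_gt_1 by (intro power_strict_increasing)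
    qed
    finally show ?thesis by (simp add: CD_measure_def C_def)
  qed
qed

lemma CD_measure_le:
  assumes "U \<subseteq> carrier P"
  shows "CD_measure P U \<le> top_measure"
    and "CD_measure P U = top_measure \<Longrightarrow> U \<in> layer ` {..n}"
proof -
  have fin: "finite (layer k)" for k using layer_subset finite_carrier finite_subset by blast
  have "CD_measure P U \<le> top_measure \<and> (CD_measure P U = top_measure \<longrightarrow> U \<in> layer ` {..n})"
    using CD_measure_dichotomy[OF assms]
  proof
    assume "\<exists>k\<le>n. U \<subseteq> layer k \<and> centralizer P U \<subseteq> layer (n - k)"
    then obtain k where k: "k \<le> n" "U \<subseteq> layer k" "centralizer P U \<subseteq> layer (n - k)" by blast
    have le: "card U \<le> card (layer k)" "card (centralizer P U) \<le> card (layer (n - k))"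
      using k fin by (auto intro: card_mono)
    have "U = layer k" if "CD_measure P U = top_measure"
    proof -
      \<comment> \<open>The centralizer is no larger than its bound, so attaining the full product
        forces \<open>U\<close> to be as large as \<open>layer k\<close>.\<close>
      have "card (layer k) * card (layer (n - k)) \<le> card U * card (layer (n - k))"
        using that le(2) card_layer_mult[OF k(1)] by (simp flip: that add: CD_measure_def)
      moreover have "card (layer (n - k)) > 0" using p_pos by (simp add: card_layer)
      ultimately have "card (layer k) \<le> card U" by simp
      then show ?thesis using k(2) fin by (metis card_seteq)
    qed
    moreover have "CD_measure P U \<le> top_measure"
      unfolding CD_measure_def card_layer_mult[OF k(1), symmetric] using le by (rule mult_le_mono)
    ultimately show ?thesis using k(1) by auto
  qed simp
  then show "CD_measure P U \<le> top_measure"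
    "CD_measure P U = top_measure \<Longrightarrow> U \<in> layer ` {..n}" by auto
qed

lemma CD_measure_layer: "k \<le> n \<Longrightarrow> CD_measure P (layer k) = top_measure"
  using CD_measure_layer_ge CD_measure_le(1) layer_subset by (simp add: le_antisym)

section \<open>The lattice is the chain of layers\<close>

lemma max_CD_measure_eq: "max_CD_measure P = top_measure"
  unfolding max_CD_measure_def
proof (rule Max_eqI)
  have "{CD_measure P U |U. subgroup U P} \<subseteq> {..top_measure}"
    using CD_measure_le(1) subgroup.subset by blast
  then show "finite {CD_measure P U |U. subgroup U P}" by (rule finite_subset) simp
  show "top_measure \<in> {CD_measure P U |U. subgroup U P}"
    using CD_measure_layer[of n] subgroup_layer by (auto intro: sym)
qed (use CD_measure_le(1) subgroup.subset in blast)

lemma CD_lattice_eq: "CD_lattice P = layer ` {..n}"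
  using CD_measure_le(2) CD_measure_layer subgroup_layer
  by (auto simp: CD_lattice_def max_CD_measure_eq dest: subgroup.subset)

lemma layer_psubset:
  assumes "k < n"
  shows "layer k \<subset> layer (Suc k)"
proof (rule psubsetI)
  show "layer k \<subseteq> layer (Suc k)" by (auto simp: layer_def)
  have "9 * n * n - 3 * (n - k) \<noteq> 9 * n * n - 3 * (n - Suc k)"
    using assms three_le by linarith
  then have "card (layer k) \<noteq> card (layer (Suc k))"
    using assms p_gt_1 by (auto simp: card_layer)
  then show "layer k \<noteq> layer (Suc k)" by auto
qed

lemma chain_CD_lattice: "subgroup_chain_of_length P n (CD_lattice P)"
  unfolding subgroup_chain_of_length_def
  using CD_lattice_eq subgroup_layer layer_psubset by blast

section \<open>The center and the central quotient\<close>

lemma group_center_eq: "group_center P = layer 0"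
proof
  show "layer 0 \<subseteq> group_center P"
    using layer_le_centralizer[of n] by (simp add: group_center_def layer_n)
  show "group_center P \<subseteq> layer 0"
  proof
    fix x assume "x \<in> group_center P"
    then have x: "x \<in> carrier P" and comm: "\<And>y. y \<in> carrier P \<Longrightarrow> x \<otimes> y = y \<otimes> x"
      by (auto simp: group_center_def centralizer_def)
    have "d x f = 0" if f: "f < 3 * n" for f
    proof -
      \<comment> \<open>The last layer is linked to every layer, including itself, so a basis vector
        there other than \<open>f\<close> detects the coordinate \<open>f\<close>.\<close>
      define e where "e = (if f = 3 * (n - 1) then 3 * (n - 1) + 1 else 3 * (n - 1))"
      have e: "e \<noteq> f" "e < 3 * n" "n \<le> e div 3 + f div 3 + 1"
        using f by (auto simp: e_def)
      define m where "m = (\<lambda>i\<in>entries n. if i = (e, e) then 1 else 0 :: int)"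
      have "m \<in> matrices n p" using p_gt_1 by (auto simp: m_def matrices_def)
      then obtain y where y: "y \<in> carrier P" "c y = m"
        using bij by (metis bij_betw_def imageE)
      have "(d x f * d y e) mod int p = (d y f * d x e) mod int p"
        using x y comm e f by (intro commute_linked) auto
      then have "int p dvd d x f" using y e f by (simp add: m_def dvd_eq_mod_eq_0)
      then show ?thesis using c_zero_iff x f by simp
    qed
    then show "x \<in> layer 0" using x by (simp add: layer_def)
  qed
qed

lemma elementary_abelian_center: "elementary_abelian p (P\<lparr>carrier := group_center P\<rparr>)"
  unfolding elementary_abelian_def
proof (intro conjI ballI)
  interpret Z: group "P\<lparr>carrier := group_center P\<rparr>"
    unfolding group_center_eq by (rule subgroup_imp_group[OF subgroup_layer])
  have comm: "x \<otimes> y = y \<otimes> x" if "x \<in> group_center P" "y \<in> group_center P" for x y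
    using that unfolding group_center_def centralizer_def by blast
  show "comm_group (P\<lparr>carrier := group_center P\<rparr>)"
    by (rule Z.group_comm_groupI) (simp add: comm)
  fix x assume "x \<in> carrier (P\<lparr>carrier := group_center P\<rparr>)"
  then have x: "x \<in> carrier P" and x0: "\<And>e. e < 3 * n \<Longrightarrow> d x e = 0"
    by (auto simp: group_center_eq layer_def)
  \<comment> \<open>The diagonal vanishes on the center, so the bilinear term disappears and powers
    are taken entrywise, also for \<open>p = 2\<close>.\<close>
  have pow: "c (x [^] (k :: nat)) (e, f) = (int k * c x (e, f)) mod int p"
    if "e < 3 * n" "f < 3 * n" for k e f
  proof (induction k)
    case (Suc k)
    then show ?case using that x x0
      by (simp add: c_mult mat_mult_apply mod_simps algebra_simps)
  qed (use that in \<open>simp add: c_one mat_zero_def\<close>)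
  have "x [^] p = \<one>"
    using x pow by (intro c_eqI) (auto simp: c_one mat_zero_def)
  then show "x [^]\<^bsub>P\<lparr>carrier := group_center P\<rparr>\<^esub> p = \<one>\<^bsub>P\<lparr>carrier := group_center P\<rparr>\<^esub>"
    by (simp flip: nat_pow_consistent)
qed

lemma normal_center: "group_center P \<lhd> P"
proof (rule normal_invI)
  show "subgroup (group_center P) P" by (simp add: group_center_eq subgroup_layer)
  show "x \<otimes> h \<otimes> inv x \<in> group_center P" if "x \<in> carrier P" "h \<in> group_center P" for x h
    using that by (auto simp: group_center_eq layer_def d_mult d_inv mod_simps)
qed

text \<open>The diagonal is a homomorphism to an additive group of exponent dividing
  \<open>p\<close>, with the center as kernel. Commutators and \<open>p\<close>-th powers therefore
  lie in the center.\<close>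

lemma elementary_abelian_quotient: "elementary_abelian p (P Mod group_center P)"
  unfolding elementary_abelian_def
proof (intro conjI ballI)
  let ?Z = "group_center P"
  interpret N: normal ?Z P by (rule normal_center)
  interpret Q: group "P Mod ?Z" by (rule N.factorgroup_is_group)
  have carrierE: "\<exists>x\<in>carrier P. A = ?Z #> x" if "A \<in> carrier (P Mod ?Z)" for A
    using that by (auto simp: FactGroup_def RCOSETS_def)
  show "comm_group (P Mod ?Z)"
  proof (rule Q.group_comm_groupI)
    fix A B assume "A \<in> carrier (P Mod ?Z)" "B \<in> carrier (P Mod ?Z)"
    then obtain x y where x: "x \<in> carrier P" "A = ?Z #> x" and y: "y \<in> carrier P" "B = ?Z #> y"
      using carrierE by metis
    have "d ((x \<otimes> y) \<otimes> inv (y \<otimes> x)) e = 0" if "e < 3 * n" for e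
    proof -
      have "d (y \<otimes> x) e = d (x \<otimes> y) e" using x(1) y(1) that by (simp add: d_mult add.commute)
      then show ?thesis
        using x(1) y(1) that by (simp only: d_mult d_inv m_closed inv_closed) (simp add: mod_simps)
    qed
    then have "(x \<otimes> y) \<otimes> inv (y \<otimes> x) \<in> ?Z"
      using x(1) y(1) by (simp only: group_center_eq layer_def mem_Collect_eq m_closed inv_closed) simp
    then have "x \<otimes> y \<in> ?Z #> (y \<otimes> x)"
      using x y N.rcos_module_rev[of "y \<otimes> x" "x \<otimes> y"] by (simp add: is_group)
    then have "?Z #> (y \<otimes> x) = ?Z #> (x \<otimes> y)"
      using x y by (intro repr_independence N.is_subgroup) auto
    then show "A \<otimes>\<^bsub>P Mod ?Z\<^esub> B = B \<otimes>\<^bsub>P Mod ?Z\<^esub> A"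
      using x y by (simp add: N.rcos_sum)
  qed
  fix A assume "A \<in> carrier (P Mod ?Z)"
  then obtain x where x: "x \<in> carrier P" "A = ?Z #> x" using carrierE by metis
  have "x [^] p \<in> ?Z"
    unfolding group_center_eq layer_def using x(1) by (simp add: d_pow)
  then have "?Z #> (x [^] p) = ?Z"
    using x(1) by (intro coset_join2 N.is_subgroup) auto
  moreover have "?Z #> (x [^] p) = (?Z #> x) [^]\<^bsub>P Mod ?Z\<^esub> p"
    using hom_nat_pow[OF N.r_coset_hom_Mod x(1) is_group Q.is_group] .
  ultimately show "A [^]\<^bsub>P Mod ?Z\<^esub> p = \<one>\<^bsub>P Mod ?Z\<^esub>"
    unfolding x(2) by (simp only: one_FactGroup)
qed

end

section \<open>Transport to the natural numbers\<close>

lemma ex_chain_group_nat: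
  assumes "Factorial_Ring.prime p"
  shows "\<exists>(P :: nat monoid) c. chain_group P n p c"
proof -
  let ?G = "mat_group n p"
  have p: "p > 0" using assms by (rule prime_gt_0_nat)
  interpret G: group ?G using p by (rule group_mat_group)
  obtain g where g: "bij_betw g (matrices n p) {0..<card (matrices n p)}"
    using ex_bij_betw_finite_nat[OF finite_matrices] by blast
  define c where "c = inv_into (matrices n p) g"
  define P where "P = \<lparr>carrier = {0..<card (matrices n p)},
    monoid.mult = (\<lambda>x y. g (mat_mult n p (c x) (c y))), one = g (mat_zero n)\<rparr>"
  have c: "bij_betw c (carrier P) (matrices n p)"
    unfolding c_def P_def using g by (simp add: bij_betw_inv_into)
  have cg: "c (g m) = m" if "m \<in> matrices n p" for m
    using that g by (simp add: c_def bij_betw_def)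
  have cmem: "c x \<in> matrices n p" if "x \<in> carrier P" for x
    using that c bij_betwE by blast
  note closed = mat_mult_closed[OF p] mat_zero_closed[OF p]
  have "g \<in> iso ?G P"
    using g closed cg by (auto simp: iso_def hom_def mat_group_def P_def bij_betw_def)
  \<comment> \<open>\<open>iso_imp_img_group\<close> yields \<open>P\<close> with its unit replaced
    by the image of the unit, and \<open>P\<close> was defined with exactly that unit.\<close>
  then have "group P" using G.iso_imp_img_group[of g P] by (simp add: P_def mat_group_def)
  then interpret P: group P .
  have "chain_group P n p c"
    by unfold_locales (use assms c cg cmem closed in \<open>auto simp: P_def\<close>)
  then show ?thesis by blast
qed

theorem corollary3p2:
  fixes n p :: nat
  assumes "Factorial_Ring.prime p"
  shows "\<exists>P :: nat monoid.
           finite_p_group p P \<and>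
           carrier P \<in> CD_lattice P \<and>
           subgroup_chain_of_length P n (CD_lattice P) \<and>
           elementary_abelian p (P Mod group_center P) \<and>
           elementary_abelian p (P\<lparr>carrier := group_center P\<rparr>)"
proof -
  obtain P :: "nat monoid" and c where "chain_group P n p c"
    using ex_chain_group_nat[OF assms] by blast
  then interpret chain_group P n p c .
  have "finite_p_group p P"
    using finite_carrier order_eq is_group by (auto simp: finite_p_group_def)
  moreover have "carrier P \<in> CD_lattice P"
    by (auto simp: CD_lattice_eq simp flip: layer_n)
  ultimately show ?thesis
    using chain_CD_lattice elementary_abelian_quotient elementary_abelian_center
    by (intro exI[of _ P] conjI)
qed

end
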